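(* For any feasible placement $\mathbf X$, the layer-weighted long-term distortion under optimal power control satisfies $$\sum_{\ell=1}^{L}a_\ell\,\mathbb E\Big[\mathrm{MSE}_\ell^{(t),\star}(\mathbf X)\Big]\ \le\ \sigma^2\sum_{\ell=1}^{L}a_\ell c_\ell^2\,\mathbb E\Bigg[\sum_{i\in S_\ell^{(t)}}\sum_{m\in\mathcal M}x_{\ell,i,m}\frac{\big(g_{\ell,i}^{(t)}\big)^2}{|h_m^{(t)}|^2P_m}\Bigg].$$
   Context: Let $\mathcal L=\{1,\dots,L\}$ (layers), $\mathcal I=\{1,\dots,I\}$ (experts per layer), $\mathcal M=\{1,\dots,M\}$ (devices) with $M\ge LI$. A feasible placement is $\mathbf X=\{x_{\ell,i,m}\in\{0,1\}\}$ with $\sum_{m}x_{\ell,i,m}=1$ for all $(\ell,i)$ and $\sum_{\ell,i}x_{\ell,i,m}\le 1$ for all $m$; it is deterministic. Constants: $a_\ell\ge0$, $c_\ell>0$, $\sigma^2>0$, power budgets $P_m>0$. For a random token $t$: $S_\ell^{(t)}\subseteq\mathcal I$ is the random activated expert set with $|S_\ell^{(t)}|=K\ge1$, $g_{\ell,i}^{(t)}\in(0,1)$ are random gating scores, and $h_m^{(t)}$ are random nonzero complex channel coefficients; $\mathbb E$ is expectation over these (of nonnegative quantities, in $[0,\infty]$). Set $H_{\ell,i}^{(t)}(\mathbf X)=\sum_{m}x_{\ell,i,m}|h_m^{(t)}|$ and $P_{\ell,i}(\mathbf X)=\sum_m x_{\ell,i,m}P_m$. For each realization, $\mathrm{MSE}_\ell^{(t),\star}(\mathbf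 X)$ is the minimum of $$c_\ell^2\Big[\sum_{i\in S_\ell^{(t)}}\Big(\frac{H_{\ell,i}^{(t)}(\mathbf X)\sqrt{p_i}}{\eta}-g_{\ell,i}^{(t)}\Big)^2+\frac{\sigma^2}{\eta^2}\Big]$$ over $\eta>0$ and $0\le p_i\le P_{\ell,i}(\mathbf X)$, $i\in S_\ell^{(t)}$. *)

theory Defs
  imports "HOL-Probability.Probability"
begin

text \<open>
  Layers, experts and devices are the index sets \<open>{1..L}\<close>, \<open>{1..I}\<close> and \<open>{1..M}\<close>;
  a placement maps (layer, expert, device) to 0 or 1.
\<close>

definition feasible_placement :: "nat \<Rightarrow> nat \<Rightarrow> nat \<Rightarrow> (nat \<Rightarrow> nat \<Rightarrow> nat \<Rightarrow> real) \<Rightarrow> bool" where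
  "feasible_placement L I M X \<longleftrightarrow>
     (\<forall>l\<in>{1..L}. \<forall>i\<in>{1..I}. \<forall>m\<in>{1..M}. X l i m \<in> {0, 1}) \<and>
     (\<forall>l\<in>{1..L}. \<forall>i\<in>{1..I}. (\<Sum>m=1..M. X l i m) = 1) \<and>
     (\<forall>m\<in>{1..M}. (\<Sum>l=1..L. \<Sum>i=1..I. X l i m) \<le> 1)"

definition channel_gain :: "nat \<Rightarrow> (nat \<Rightarrow> nat \<Rightarrow> nat \<Rightarrow> real) \<Rightarrow> (nat \<Rightarrow> complex) \<Rightarrow> nat \<Rightarrow> nat \<Rightarrow> real" where
  "channel_gain M X h l i = (\<Sum>m=1..M. X l i m * cmod (h m))"

definition power_budget :: "nat \<Rightarrow> (nat \<Rightarrow> nat \<Rightarrow> nat \<Rightarrow> real) \<Rightarrow> (nat \<Rightarrow> real) \<Rightarrow> nat \<Rightarrow> nat \<Rightarrow> real" where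
  "power_budget M X P l i = (\<Sum>m=1..M. X l i m * P m)"

text \<open>
  The next three definitions concern a single layer and a single realization: \<open>S\<close> is the
  activated expert set, and \<open>g\<close>, \<open>H\<close>, \<open>Q\<close> are the gating scores, channel gains and power
  budgets as functions of the expert.
\<close>

definition mse :: "real \<Rightarrow> real \<Rightarrow> nat set \<Rightarrow> (nat \<Rightarrow> real) \<Rightarrow> (nat \<Rightarrow> real) \<Rightarrow> real \<Rightarrow> (nat \<Rightarrow> real) \<Rightarrow> real" where
  "mse c \<sigma> S g H \<eta> p =
     c\<^sup>2 * ((\<Sum>i\<in>S. (H i * sqrt (p i) / \<eta> - g i)\<^sup>2) + \<sigma>\<^sup>2 / \<eta>\<^sup>2)"

definition feasible_control :: "nat set \<Rightarrow> (nat \<Rightarrow> real) \<Rightarrow> real \<Rightarrow> (nat \<Rightarrow> real) \<Rightarrow> bool" where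
  "feasible_control S Q \<eta> p \<longleftrightarrow> \<eta> > 0 \<and> (\<forall>i\<in>S. 0 \<le> p i \<and> p i \<le> Q i)"

text \<open>
  The minimum is meant literally, as the least element of the set of attained values. It exists
  although the range of \<open>\<eta>\<close> is neither closed nor bounded; see \<open>min_mse_attained\<close> below.
\<close>

definition min_mse :: "real \<Rightarrow> real \<Rightarrow> nat set \<Rightarrow> (nat \<Rightarrow> real) \<Rightarrow> (nat \<Rightarrow> real) \<Rightarrow> (nat \<Rightarrow> real) \<Rightarrow> real" where
  "min_mse c \<sigma> S g H Q =
     (LEAST v. \<exists>\<eta> p. feasible_control S Q \<eta> p \<and> v = mse c \<sigma> S g H \<eta> p)"

lemma mse_minimum_exists:
  fixes \<sigma> c :: real
  assumes fin: "finite S" and ne: "S \<noteq> {}" and sg: "\<sigma>\<^sup>2 > 0"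
    and g: "\<And>i. i \<in> S \<Longrightarrow> g i > 0" and H: "\<And>i. i \<in> S \<Longrightarrow> H i > 0" and Q: "\<And>i. i \<in> S \<Longrightarrow> Q i > 0"
  shows "\<exists>\<eta> p. feasible_control S Q \<eta> p \<and>
           (\<forall>\<eta>' p'. feasible_control S Q \<eta>' p' \<longrightarrow> mse c \<sigma> S g H \<eta> p \<le> mse c \<sigma> S g H \<eta>' p')"
proof -
  define b where "b i = H i * sqrt (Q i)" for i
  have b: "b i > 0" if "i \<in> S" for i using H Q that by (simp add: b_def)
  define f where "f s = (\<Sum>i\<in>S. (max 0 (g i - b i * s))\<^sup>2) + \<sigma>\<^sup>2 * s\<^sup>2" for s
  define A where "A = (\<Sum>i\<in>S. g i * b i)"
  define D where "D = (\<Sum>i\<in>S. (b i)\<^sup>2) + \<sigma>\<^sup>2"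
  have A: "A > 0" unfolding A_def using fin ne g b by (intro sum_pos) auto
  have D: "D > 0" unfolding D_def using sg by (intro add_nonneg_pos sum_nonneg) auto
  have f0: "f 0 = (\<Sum>i\<in>S. (g i)\<^sup>2)"
    unfolding f_def using g by (auto intro!: sum.cong simp: max_def less_imp_le dest: g)
  define B where "B = sqrt (f 0 / \<sigma>\<^sup>2)"
  have B0: "B \<ge> 0" unfolding B_def f0 by (simp add: sum_nonneg)
  have Bbig: "f 0 \<le> f s" if "s \<ge> B" for s
  proof -
    have "B\<^sup>2 \<le> s\<^sup>2" using that B0 by (intro power_mono)
    moreover have "B\<^sup>2 = f 0 / \<sigma>\<^sup>2" unfolding B_def f0 by (simp add: sum_nonneg)
    ultimately have "f 0 \<le> \<sigma>\<^sup>2 * s\<^sup>2" using sg by (simp add: field_simps)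
    also have "\<dots> \<le> f s" unfolding f_def by (simp add: sum_nonneg)
    finally show ?thesis .
  qed
  have "continuous_on {0..B} f" unfolding f_def by (intro continuous_intros)
  then obtain s where s: "s \<in> {0..B}" and smin: "\<And>s'. s' \<in> {0..B} \<Longrightarrow> f s \<le> f s'"
    using continuous_attains_inf[of "{0..B}" f] B0 by auto
  have glob: "f s \<le> f s'" if "s' \<ge> 0" for s'
  proof (cases "s' \<le> B")
    case True then show ?thesis using smin that by simp
  next
    case False then show ?thesis using Bbig[of s'] smin[of 0] B0 by simp
  qed
  define t where "t = min (Min ((\<lambda>i. g i / b i) ` S)) (A / D)"
  have t: "t > 0" unfolding t_def using fin ne g b A D by simp
  have tb: "b i * t \<le> g i" if "i \<in> S" for i
  proof -
    have "t \<le> Min ((\<lambda>i. g i / b i) ` S)" unfolding t_def by simp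
    also have "\<dots> \<le> g i / b i" using fin that by simp
    finally show ?thesis using b[OF that] by (simp add: field_simps)
  qed
  have "t \<le> A / D" unfolding t_def by simp
  hence tD: "t * D \<le> A" using D by (simp add: field_simps)
  have "f t = (\<Sum>i\<in>S. (g i - b i * t)\<^sup>2) + \<sigma>\<^sup>2 * t\<^sup>2"
    unfolding f_def by (auto intro!: sum.cong simp: max_def dest: tb)
  also have "\<dots> = f 0 - 2 * t * A + t\<^sup>2 * D"
    unfolding f0 A_def D_def
    by (simp add: power2_diff power_mult_distrib sum.distrib sum_subtractf sum_distrib_left algebra_simps)
  also have "\<dots> \<le> f 0 - t * A"
    using mult_left_mono[OF tD, of t] t by (simp add: power2_eq_square algebra_simps)
  also have "\<dots> < f 0" using t A by simp
  finally have "f t < f 0" .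
  with glob[of t] t have "s \<noteq> 0" by auto
  with s have s0: "s > 0" by simp
  define p where "p i = (min (b i * s) (g i) / (s * H i))\<^sup>2" for i
  have sq: "sqrt (p i) = min (b i * s) (g i) / (s * H i)" if "i \<in> S" for i
    unfolding p_def using b[OF that] g[OF that] H[OF that] s0 by simp
  have pc: "feasible_control S Q (1/s) p"
    unfolding feasible_control_def
  proof (intro conjI ballI)
    fix i assume i: "i \<in> S"
    have "sqrt (p i) \<le> sqrt (Q i)"
      unfolding sq[OF i] using H[OF i] s0
      by (simp add: pos_divide_le_eq b_def min_le_iff_disj mult_ac)
    then show "p i \<le> Q i" by simp
  qed (use s0 in \<open>auto simp: p_def\<close>)
  have val: "mse c \<sigma> S g H (1/s) p = c\<^sup>2 * f s"
  proof -
    have "(H i * sqrt (p i) / (1/s) - g i)\<^sup>2 = (max 0 (g i - b i * s))\<^sup>2" if "i \<in> S" for i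
      unfolding sq[OF that] using H[OF that] s0
      by (auto simp: min_def max_def field_simps power2_commute)
    then show ?thesis unfolding mse_def f_def by (simp add: power_divide)
  qed
  have low: "c\<^sup>2 * f s \<le> mse c \<sigma> S g H \<eta>' p'" if fc: "feasible_control S Q \<eta>' p'" for \<eta>' p'
  proof -
    have e: "\<eta>' > 0" using fc by (simp add: feasible_control_def)
    have "(max 0 (g i - b i * (1/\<eta>')))\<^sup>2 \<le> (H i * sqrt (p' i) / \<eta>' - g i)\<^sup>2" if i: "i \<in> S" for i
    proof -
      have "sqrt (p' i) \<le> sqrt (Q i)" using fc i by (simp add: feasible_control_def)
      then have "H i * sqrt (p' i) / \<eta>' \<le> b i * (1/\<eta>')"
        unfolding b_def using H[OF i] e by (simp add: divide_right_mono)
      then have "\<bar>max 0 (g i - b i * (1/\<eta>'))\<bar> \<le> \<bar>H i * sqrt (p' i) / \<eta>' - g i\<bar>" by linarith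
      then show ?thesis by (simp only: abs_le_square_iff)
    qed
    then have "f (1/\<eta>') \<le> (\<Sum>i\<in>S. (H i * sqrt (p' i) / \<eta>' - g i)\<^sup>2) + \<sigma>\<^sup>2 / \<eta>'\<^sup>2"
      unfolding f_def by (simp add: sum_mono power_divide)
    with glob[of "1/\<eta>'"] e show ?thesis
      unfolding mse_def by (intro mult_left_mono) auto
  qed
  show ?thesis using pc val low by metis
qed

lemma min_mse_attained:
  fixes \<sigma> c :: real
  assumes "finite S" "S \<noteq> {}" "\<sigma>\<^sup>2 > 0"
    and "\<And>i. i \<in> S \<Longrightarrow> g i > 0" "\<And>i. i \<in> S \<Longrightarrow> H i > 0" "\<And>i. i \<in> S \<Longrightarrow> Q i > 0"
  shows "\<exists>\<eta> p. feasible_control S Q \<eta> p \<and> min_mse c \<sigma> S g H Q = mse c \<sigma> S g H \<eta> p"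
    and "feasible_control S Q \<eta>' p' \<Longrightarrow> min_mse c \<sigma> S g H Q \<le> mse c \<sigma> S g H \<eta>' p'"
proof -
  obtain \<eta> p where fc: "feasible_control S Q \<eta> p"
    and least: "\<And>\<eta>' p'. feasible_control S Q \<eta>' p' \<Longrightarrow> mse c \<sigma> S g H \<eta> p \<le> mse c \<sigma> S g H \<eta>' p'"
    using mse_minimum_exists[of S \<sigma> g H Q c] assms by blast
  have eq: "min_mse c \<sigma> S g H Q = mse c \<sigma> S g H \<eta> p"
    unfolding min_mse_def by (rule Least_equality) (use fc least in auto)
  show "\<exists>\<eta> p. feasible_control S Q \<eta> p \<and> min_mse c \<sigma> S g H Q = mse c \<sigma> S g H \<eta> p"
    using fc eq by blast
  show "feasible_control S Q \<eta>' p' \<Longrightarrow> min_mse c \<sigma> S g H Q \<le> mse c \<sigma> S g H \<eta>' p'"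
    using least eq by simp
qed

end

theory Submission imports Defs begin

text \<open>
  Full channel inversion is feasible as long as \<open>\<eta>\<close> does not exceed \<open>H i * sqrt (Q i) / g i\<close>
  for any active expert \<open>i\<close>. Taking \<open>\<eta>\<close> to be the least of these bounds kills the misalignment
  terms, and the remaining noise \<open>\<sigma>\<^sup>2 / \<eta>\<^sup>2\<close> is the largest of the numbers
  \<open>\<sigma>\<^sup>2 * (g i)\<^sup>2 / ((H i)\<^sup>2 * Q i)\<close>, hence at most their sum.
\<close>

lemma min_mse_le_sum:
  fixes \<sigma> c :: real
  assumes fin: "finite S" and ne: "S \<noteq> {}" and sg: "\<sigma>\<^sup>2 > 0"
    and g: "\<And>i. i \<in> S \<Longrightarrow> g i > 0" and H: "\<And>i. i \<in> S \<Longrightarrow> H i > 0" and Q: "\<And>i. i \<in> S \<Longrightarrow> Q i > 0"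
  shows "min_mse c \<sigma> S g H Q \<le> c\<^sup>2 * \<sigma>\<^sup>2 * (\<Sum>i\<in>S. (g i)\<^sup>2 / ((H i)\<^sup>2 * Q i))"
proof -
  define r where "r i = H i * sqrt (Q i) / g i" for i
  have r: "r i > 0" if "i \<in> S" for i
    using that g H Q by (simp add: r_def)
  define \<eta> where "\<eta> = Min (r ` S)"
  obtain j where j: "j \<in> S" "\<eta> = r j"
    using Min_in[of "r ` S"] fin ne unfolding \<eta>_def by blast
  have \<eta>: "\<eta> > 0" using j r by simp
  \<comment> \<open>Solves \<open>H i * sqrt (p i) / \<eta> = g i\<close>; the bound
    \<open>\<eta> \<le> r i\<close> is what keeps this power within \<open>Q i\<close>.\<close>
  define p where "p i = (g i * \<eta> / H i)\<^sup>2" for i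
  have sqrt_p: "sqrt (p i) = g i * \<eta> / H i" if "i \<in> S" for i
    unfolding p_def using that g[OF that] H[OF that] \<eta> by simp
  have "feasible_control S Q \<eta> p"
    unfolding feasible_control_def
  proof (intro conjI ballI)
    fix i assume i: "i \<in> S"
    have "\<eta> \<le> r i" unfolding \<eta>_def using i fin by simp
    then have "sqrt (p i) \<le> sqrt (Q i)"
      unfolding sqrt_p[OF i] r_def using g[OF i] H[OF i] by (simp add: field_simps)
    then show "p i \<le> Q i" by simp
  qed (use \<eta> in \<open>auto simp: p_def\<close>)
  then have "min_mse c \<sigma> S g H Q \<le> mse c \<sigma> S g H \<eta> p"
    by (rule min_mse_attained(2)[rotated -1]) (use assms in auto)
  also have "\<dots> = c\<^sup>2 * \<sigma>\<^sup>2 * ((g j)\<^sup>2 / ((H j)\<^sup>2 * Q j))"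
  proof -
    have "(H i * sqrt (p i) / \<eta> - g i)\<^sup>2 = 0" if "i \<in> S" for i
      unfolding sqrt_p[OF that] using H[OF that] \<eta> by simp
    moreover have "\<eta>\<^sup>2 = (H j)\<^sup>2 * Q j / (g j)\<^sup>2"
      using j Q[of j] by (simp add: r_def power_divide power_mult_distrib)
    ultimately show ?thesis by (simp add: mse_def)
  qed
  also have "\<dots> \<le> c\<^sup>2 * \<sigma>\<^sup>2 * (\<Sum>i\<in>S. (g i)\<^sup>2 / ((H i)\<^sup>2 * Q i))"
    using j fin by (intro mult_left_mono member_le_sum) (auto intro!: divide_nonneg_nonneg simp: less_imp_le Q)
  finally show ?thesis .
qed

text \<open>Weights in {0, 1} with total 1 are the indicator of one point. The point
  \<open>k\<close> is fixed before \<open>f\<close>, so different weighted sums can all be evaluated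
  at the same device.\<close>

lemma sum_zero_one_eq_one:
  fixes x :: "'a \<Rightarrow> real"
  assumes fin: "finite A" and bin: "\<And>m. m \<in> A \<Longrightarrow> x m \<in> {0, 1}" and sum: "(\<Sum>m\<in>A. x m) = 1"
  obtains k where "k \<in> A" "\<And>f :: 'a \<Rightarrow> real. (\<Sum>m\<in>A. x m * f m) = f k"
proof -
  obtain k where k: "k \<in> A" "x k = 1"
    using sum bin by (metis (no_types, lifting) insertE singletonD sum.neutral zero_neq_one)
  \<comment> \<open>The remaining weights are nonnegative and add up to 0, so each of them
    vanishes.\<close>
  have "(\<Sum>m\<in>A - {k}. x m) = 0"
    using sum k fin by (simp add: sum.remove[of A k])
  then have "x m = 0" if "m \<in> A - {k}" for m
    using that fin bin by (subst (asm) sum_nonneg_eq_0_iff) fastforce+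
  then have "(\<Sum>m\<in>A. x m * f m) = f k" for f
    using k fin by (simp add: sum.remove[of A k])
  with k(1) show ?thesis by (rule that)
qed

text \<open>The index set is itself random, but it takes only finitely many values, so it is enough
  to treat each fixed value \<open>B\<close> of \<open>S\<close>.\<close>

lemma borel_measurable_random_sum:
  fixes f :: "'i \<Rightarrow> 'w \<Rightarrow> real"
  assumes "finite A" and S: "S \<in> measurable \<Omega> (count_space (Pow A))"
    and [measurable]: "\<And>i. i \<in> A \<Longrightarrow> f i \<in> borel_measurable \<Omega>"
  shows "(\<lambda>\<omega>. \<Sum>i\<in>S \<omega>. f i \<omega>) \<in> borel_measurable \<Omega>"
proof (rule measurable_compose_countable'[OF _ S])
  show "countable (Pow A)"
    using assms(1) by (simp add: countable_finite)
  show "(\<lambda>\<omega>. \<Sum>i\<in>B. f i \<omega>) \<in> borel_measurable \<Omega>" if "B \<in> Pow A" for B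
    using that by (intro borel_measurable_sum) auto
qed

theorem lemma3:
  fixes L I M K :: nat
    and X :: "nat \<Rightarrow> nat \<Rightarrow> nat \<Rightarrow> real"
    and a c P :: "nat \<Rightarrow> real"
    and \<sigma> :: real
    and \<Omega> :: "'w measure"
    and S :: "nat \<Rightarrow> 'w \<Rightarrow> nat set"
    and g :: "nat \<Rightarrow> nat \<Rightarrow> 'w \<Rightarrow> real"
    and h :: "nat \<Rightarrow> 'w \<Rightarrow> complex"
  assumes "M \<ge> L * I"
    and "feasible_placement L I M X"
    and "\<And>l. l \<in> {1..L} \<Longrightarrow> a l \<ge> 0"
    and "\<And>l. l \<in> {1..L} \<Longrightarrow> c l > 0"
    and "\<sigma>\<^sup>2 > 0"
    and "\<And>m. m \<in> {1..M} \<Longrightarrow> P m > 0"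
    and "prob_space \<Omega>"
    and "K \<ge> 1"
    and "\<And>l. l \<in> {1..L} \<Longrightarrow> S l \<in> measurable \<Omega> (count_space (Pow {1..I}))"
    and "\<And>l \<omega>. l \<in> {1..L} \<Longrightarrow> \<omega> \<in> space \<Omega> \<Longrightarrow> card (S l \<omega>) = K"
    and "\<And>l i. l \<in> {1..L} \<Longrightarrow> i \<in> {1..I} \<Longrightarrow> g l i \<in> borel_measurable \<Omega>"
    and "\<And>l i \<omega>. l \<in> {1..L} \<Longrightarrow> i \<in> {1..I} \<Longrightarrow> \<omega> \<in> space \<Omega> \<Longrightarrow> g l i \<omega> \<in> {0<..<1}"
    and "\<And>m. m \<in> {1..M} \<Longrightarrow> h m \<in> borel_measurable \<Omega>"
    and "\<And>m \<omega>. m \<in> {1..M} \<Longrightarrow> \<omega> \<in> space \<Omega> \<Longrightarrow> h m \<omega> \<noteq> 0"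
  shows "(\<Sum>l=1..L. ennreal (a l) *
            (\<integral>\<^sup>+\<omega>. ennreal (min_mse (c l) \<sigma> (S l \<omega>) (\<lambda>i. g l i \<omega>)
                (channel_gain M X (\<lambda>m. h m \<omega>) l) (power_budget M X P l)) \<partial>\<Omega>))
         \<le> ennreal (\<sigma>\<^sup>2) *
           (\<Sum>l=1..L. ennreal (a l * (c l)\<^sup>2) *
              (\<integral>\<^sup>+\<omega>. ennreal (\<Sum>i\<in>S l \<omega>. \<Sum>m=1..M.
                  X l i m * ((g l i \<omega>)\<^sup>2 / ((cmod (h m \<omega>))\<^sup>2 * P m))) \<partial>\<Omega>))"
proof -
  define F where "F l \<omega> = (\<Sum>i\<in>S l \<omega>. \<Sum>m=1..M.
      X l i m * ((g l i \<omega>)\<^sup>2 / ((cmod (h m \<omega>))\<^sup>2 * P m)))" for l \<omega>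
  have pointwise: "min_mse (c l) \<sigma> (S l \<omega>) (\<lambda>i. g l i \<omega>)
      (channel_gain M X (\<lambda>m. h m \<omega>) l) (power_budget M X P l) \<le> (c l)\<^sup>2 * \<sigma>\<^sup>2 * F l \<omega>"
    if l: "l \<in> {1..L}" and \<omega>: "\<omega> \<in> space \<Omega>" for l \<omega>
  proof -
    let ?H = "channel_gain M X (\<lambda>m. h m \<omega>) l" and ?Q = "power_budget M X P l"
    have sub: "S l \<omega> \<subseteq> {1..I}"
      using measurable_space[OF assms(9)[OF l] \<omega>] by simp
    have fin: "finite (S l \<omega>)" using sub finite_subset by blast
    \<comment> \<open>With no active expert only the noise
      \<open>\<sigma>\<^sup>2 / \<eta>\<^sup>2\<close> would be left, whose infimum 0 is not
      attained; \<open>K \<ge> 1\<close> excludes this case.\<close>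
    have ne: "S l \<omega> \<noteq> {}" using assms(8) assms(10)[OF l \<omega>] by auto
    \<comment> \<open>Let \<open>k\<close> be the device hosting expert \<open>i\<close>. Gain,
      budget and inner sum reduce to \<open>cmod (h k \<omega>)\<close>, \<open>P k\<close> and the
      single quotient at \<open>k\<close>, so the deterministic bound turns into \<open>F\<close>
      with equality.\<close>
    have expert: "?H i > 0 \<and> ?Q i > 0 \<and>
        (\<Sum>m=1..M. X l i m * ((g l i \<omega>)\<^sup>2 / ((cmod (h m \<omega>))\<^sup>2 * P m))) = (g l i \<omega>)\<^sup>2 / ((?H i)\<^sup>2 * ?Q i)"
      if "i \<in> S l \<omega>" for i
    proof -
      have "i \<in> {1..I}" using that sub by auto
      then have "\<And>m. m \<in> {1..M} \<Longrightarrow> X l i m \<in> {0, 1}" "(\<Sum>m=1..M. X l i m) = 1"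
        using assms(2) l unfolding feasible_placement_def by blast+
      then obtain k where k: "k \<in> {1..M}" "\<And>f :: nat \<Rightarrow> real. (\<Sum>m=1..M. X l i m * f m) = f k"
        using sum_zero_one_eq_one[of "{1..M}" "X l i"] by blast
      show ?thesis
        unfolding channel_gain_def power_budget_def k(2)
        using assms(6)[OF k(1)] assms(14)[OF k(1) \<omega>] by simp
    qed
    have "min_mse (c l) \<sigma> (S l \<omega>) (\<lambda>i. g l i \<omega>) ?H ?Q
        \<le> (c l)\<^sup>2 * \<sigma>\<^sup>2 * (\<Sum>i\<in>S l \<omega>. (g l i \<omega>)\<^sup>2 / ((?H i)\<^sup>2 * ?Q i))"
      by (rule min_mse_le_sum) (use fin ne assms(5) assms(12)[OF l _ \<omega>] sub expert in auto)
    also have "\<dots> = (c l)\<^sup>2 * \<sigma>\<^sup>2 * F l \<omega>"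
      unfolding F_def using expert by simp
    finally show ?thesis .
  qed
  have F: "F l \<in> borel_measurable \<Omega>" if "l \<in> {1..L}" for l
  proof -
    note [measurable] = assms(11)[OF that] assms(13)
    show ?thesis
      unfolding F_def by (rule borel_measurable_random_sum[OF _ assms(9)[OF that]]) measurable
  qed
  have layer: "ennreal (a l) * (\<integral>\<^sup>+\<omega>. ennreal (min_mse (c l) \<sigma> (S l \<omega>) (\<lambda>i. g l i \<omega>)
        (channel_gain M X (\<lambda>m. h m \<omega>) l) (power_budget M X P l)) \<partial>\<Omega>)
      \<le> ennreal (\<sigma>\<^sup>2) * (ennreal (a l * (c l)\<^sup>2) * (\<integral>\<^sup>+\<omega>. ennreal (F l \<omega>) \<partial>\<Omega>))"
    (is "_ * ?E \<le> _") if l: "l \<in> {1..L}" for l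
  proof -
    \<comment> \<open>Monotonicity of the nonnegative integral holds for arbitrary functions, so the
      minimal MSE is never shown to be measurable. Measurability of \<open>F l\<close> enters only
      when the constant is pulled out.\<close>
    have "?E \<le> (\<integral>\<^sup>+\<omega>. ennreal ((c l)\<^sup>2 * \<sigma>\<^sup>2) * ennreal (F l \<omega>) \<partial>\<Omega>)"
      using pointwise[OF l] by (intro nn_integral_mono) (simp add: ennreal_leI flip: ennreal_mult')
    also have "\<dots> = ennreal ((c l)\<^sup>2 * \<sigma>\<^sup>2) * (\<integral>\<^sup>+\<omega>. ennreal (F l \<omega>) \<partial>\<Omega>)"
      using F[OF l] by (intro nn_integral_cmult) measurable
    finally have "ennreal (a l) * ?E
        \<le> ennreal (a l) * (ennreal ((c l)\<^sup>2 * \<sigma>\<^sup>2) * (\<integral>\<^sup>+\<omega>. ennreal (F l \<omega>) \<partial>\<Omega>))"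
      by (rule mult_left_mono) simp
    then show ?thesis
      \<comment> \<open>\<open>ennreal\<close> sends negative reals to 0, so regrouping the
        constants as a product in \<open>ennreal\<close> relies on
        \<open>a l \<ge> 0\<close>.\<close>
      using assms(3)[OF l] by (simp add: ennreal_mult mult_ac)
  qed
  \<comment> \<open>Moving \<open>\<sigma>\<^sup>2\<close> inside the sum over layers leaves exactly
    the layerwise inequalities.\<close>
  show ?thesis
    unfolding sum_distrib_left F_def[symmetric] by (intro sum_mono layer)
qed

end
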